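(* There exists a strong distinct infinite covering system with least modulus $m=6$ and all of whose moduli are of the form $2^a 3^b 5^c$, where $a$, $b$, $c$ are nonnegative integers with $b \leq 2$ and $c \leq 1$.
   Context: Let $S=\{n_1,n_2,\ldots\}$ be an infinite set of positive integers, all greater than $1$ (the $n_k$ being distinct), and let $\mathcal{C} = \{x \equiv a_k \pmod{n_k} : k\in\mathbb{N}\}$ be a system consisting of one congruence for each modulus $n_k \in S$. For each $k \in \mathbb{N}$ let $g(k)$ be the least common multiple of $n_1,\ldots,n_k$, and let $f(k)$ be the number of integers $x$ with $0 \leq x < g(k)$ that satisfy at least one of the congruences $x \equiv a_i \pmod{n_i}$, $i=1,\ldots,k$. The system $\mathcal{C}$ is called a strong (distinct) infinite covering system if $\lim_{k\to\infty} \frac{f(k)}{g(k)} = 1$ and every integer satisfies at least one of the congruences in $\mathcal{C}$. The word "distinct" means that the moduli of the congruences are distinct integers greater than $1$. The least modulus is the smallest element of $S$. *)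

theory Defs
  imports Complex_Main "HOL-Number_Theory.Cong"
begin

text \<open>
  A system of congruences \<open>x \<equiv> a\<^sub>k (mod n\<^sub>k)\<close> is a pair of sequences \<open>n\<close> (moduli) and
  \<open>a\<close> (residues).  Sequences are indexed from 0, so the first \<open>k\<close> congruences are those with
  index \<open>i < k\<close>.
\<close>

definition lcm_first :: "(nat \<Rightarrow> nat) \<Rightarrow> nat \<Rightarrow> nat" where
  "lcm_first n k = Lcm (n ` {..<k})"

definition count_first :: "(nat \<Rightarrow> nat) \<Rightarrow> (nat \<Rightarrow> int) \<Rightarrow> nat \<Rightarrow> nat" where
  "count_first n a k =
     card {x :: int. 0 \<le> x \<and> x < int (lcm_first n k) \<and> (\<exists>i<k. [x = a i] (mod int (n i)))}"

definition distinct_infinite_system :: "(nat \<Rightarrow> nat) \<Rightarrow> bool" where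
  "distinct_infinite_system n \<longleftrightarrow> inj n \<and> (\<forall>k. n k > 1)"

definition strong_distinct_infinite_covering_system ::
    "(nat \<Rightarrow> nat) \<Rightarrow> (nat \<Rightarrow> int) \<Rightarrow> bool" where
  "strong_distinct_infinite_covering_system n a \<longleftrightarrow>
     distinct_infinite_system n \<and>
     (\<lambda>k. real (count_first n a k) / real (lcm_first n k)) \<longlonglongrightarrow> 1 \<and>
     (\<forall>x :: int. \<exists>k. [x = a k] (mod int (n k)))"

definition least_modulus :: "(nat \<Rightarrow> nat) \<Rightarrow> nat" where
  "least_modulus n = (LEAST m. m \<in> range n)"

end

theory Submission
  imports Defs "HOL-Library.Infinite_Set"
begin

text \<open>
  The infinite chain of moduli \<open>2M, 4M, 8M, \<dots>\<close> can do the work of the single modulus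
  \<open>M\<close>. Inside the class \<open>r\<close> modulo \<open>M\<close> the modulus
  \<open>2M\<close> takes one half, \<open>4M\<close> takes one half of the rest, and so on; after
  \<open>K\<close> steps only one class modulo \<open>M * 2 ^ K\<close> is left. Its density tends to
  \<open>0\<close>, and in the limit a single \<open>2\<close>-adic integer survives. If
  the halves are chosen so that this survivor is not an ordinary integer, every integer of the
  class is covered. The choice made here is \<open>x = r + M * y\<close> with survivor
  \<open>y = -1/3\<close> (lemma \<open>dyadic_splitting\<close>).

  Hence a finite cover suffices, in which a modulus \<open>M\<close> stands for its chain. The
  modulus \<open>M\<close> is not itself spent in this way: \<open>12\<close> may be used once as
  itself and once more through \<open>24, 48, \<dots>\<close>, and \<open>4\<close> may be used
  through \<open>8, 16, \<dots>\<close> although it is smaller than \<open>6\<close>. The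
  conversion of such a finite cover into a strong infinite covering system is
  \<open>strong_covering_from_finite_cover\<close>; the limit in its conclusion comes from
  \<open>covered_density_tendsto_1\<close>.

  It remains to exhibit one finite cover. The reciprocals of all numbers \<open>2^a * 3^b * 5^c\<close>
  with \<open>b \<le> 2\<close>, \<open>c \<le> 1\<close> that are at least \<open>6\<close> sum to
  \<open>71/60\<close>, so there is some room for overlaps, and seventeen classes whose
  moduli divide \<open>180\<close> are enough (lemma \<open>heads_tails_cover\<close>).
\<close>

section \<open>Density of the covered set\<close>

lemma card_residue_class_le:
  fixes m G :: nat and c :: int
  assumes "m > 0" "m dvd G"
  shows "real (card {x. 0 \<le> x \<and> x < int G \<and> [x = c] (mod int m)}) \<le> real G / real m"
proof -
  obtain q where q: "G = m * q" using assms(2) by blast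
  have "{x. 0 \<le> x \<and> x < int G \<and> [x = c] (mod int m)}
          \<subseteq> (\<lambda>i. c mod int m + int m * int i) ` {..<q}" (is "?A \<subseteq> ?f ` _")
  proof
    fix x assume x: "x \<in> ?A"
    have "x = c mod int m + int m * (x div int m)"
      using x by (metis (no_types, lifting) cong_def mem_Collect_eq mod_mult_div_eq)
    moreover have "0 \<le> x div int m" using x assms(1) by (simp add: pos_imp_zdiv_nonneg_iff)
    moreover have "x div int m < int q"
    proof -
      have "int m * (x div int m) \<le> x"
        using assms(1) by (metis mult_div_mod_eq of_nat_0_less_iff pos_mod_sign le_add_same_cancel1)
      also have "\<dots> < int m * int q" using x q by simp
      finally show ?thesis using assms(1) by simp
    qed
    ultimately show "x \<in> ?f ` {..<q}"
      by (intro image_eqI[where x = "nat (x div int m)"]) auto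
  qed
  then have "card ?A \<le> card (?f ` {..<q})" by (intro card_mono) auto
  also have "\<dots> \<le> q" using card_image_le[of "{..<q}" ?f] by simp
  finally show ?thesis using q assms(1) by simp
qed

lemma lcm_first_pos:
  assumes "\<And>i. n i > 0"
  shows "lcm_first n k > 0"
proof -
  have "0 \<notin> n ` {..<k}" using assms by (metis imageE less_irrefl)
  then have "Lcm (n ` {..<k}) \<noteq> 0" by (simp add: Lcm_0_iff)
  then show ?thesis by (metis lcm_first_def neq0_conv)
qed

lemma lcm_first_dvd_mono: "k \<le> l \<Longrightarrow> lcm_first n k dvd lcm_first n l"
  unfolding lcm_first_def by (intro Lcm_subset image_mono) auto

text \<open>
  It is enough to bound the uncovered set after finitely many congruences by a set
  \<open>R\<close> of residue classes of small total density: later congruences only shrink the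
  uncovered set. The moduli in \<open>R\<close> divide the least common multiple from that point on,
  so in every later period each class has exactly its proportional share of elements and no error
  terms arise.
\<close>

lemma covered_density_tendsto_1:
  fixes n :: "nat \<Rightarrow> nat" and a :: "nat \<Rightarrow> int"
  assumes pos: "\<And>i. n i > 0"
    and small: "\<And>e :: real. e > 0 \<Longrightarrow> \<exists>(R :: (nat \<times> int) set) k. finite R \<and>
      (\<forall>(m, c)\<in>R. m > 0 \<and> m dvd lcm_first n k) \<and> (\<Sum>(m, c)\<in>R. 1 / real m) < e \<and>
      (\<forall>x. (\<exists>i<k. [x = a i] (mod int (n i))) \<or> (\<exists>(m, c)\<in>R. [x = c] (mod int m)))"
  shows "(\<lambda>k. real (count_first n a k) / real (lcm_first n k)) \<longlonglongrightarrow> 1"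
proof (rule LIMSEQ_I)
  fix e :: real assume "e > 0"
  from small[OF this] obtain R :: "(nat \<times> int) set" and k where R: "finite R"
    "\<forall>(m, c)\<in>R. m > 0 \<and> m dvd lcm_first n k" "(\<Sum>(m, c)\<in>R. 1 / real m) < e"
    and cov: "\<forall>x. (\<exists>i<k. [x = a i] (mod int (n i))) \<or> (\<exists>(m, c)\<in>R. [x = c] (mod int m))"
    by (elim exE conjE) (rule that)
  have "norm (real (count_first n a l) / real (lcm_first n l) - 1) < e" if "l \<ge> k" for l
  proof -
    define G where "G = lcm_first n l"
    have G: "G > 0" unfolding G_def using pos by (rule lcm_first_pos)
    define A where "A = {x. 0 \<le> x \<and> x < int G \<and> (\<exists>i<l. [x = a i] (mod int (n i)))}"
    define B where "B = (\<lambda>(m, c). {x. 0 \<le> x \<and> x < int G \<and> [x = c] (mod int m)})"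
    have sub: "A \<subseteq> {0..<int G}" by (auto simp: A_def)
    then have finA: "finite A" using finite_subset by blast
    have "{0..<int G} - A \<subseteq> (\<Union>p\<in>R. B p)"
    proof
      fix x assume x: "x \<in> {0..<int G} - A"
      then have "\<not> (\<exists>i<k. [x = a i] (mod int (n i)))"
        using that by (auto simp: A_def)
      with cov x show "x \<in> (\<Union>p\<in>R. B p)" by (force simp: B_def)
    qed
    moreover have finB: "finite (B p)" for p
      by (rule finite_subset[of _ "{0..<int G}"]) (auto simp: B_def split: prod.splits)
    ultimately have "card ({0..<int G} - A) \<le> card (\<Union>p\<in>R. B p)"
      using R(1) by (intro card_mono) auto
    also have "\<dots> \<le> (\<Sum>p\<in>R. card (B p))" using R(1) by (rule card_UN_le)
    finally have "real (card ({0..<int G} - A)) \<le> (\<Sum>p\<in>R. real (card (B p)))"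
      by (metis of_nat_le_iff of_nat_sum)
    also have "\<dots> \<le> (\<Sum>(m, c)\<in>R. real G / real m)"
    proof (intro sum_mono, clarify)
      fix m c assume "(m, c) \<in> R"
      with R(2) lcm_first_dvd_mono[OF that, of n] have "m > 0" "m dvd G"
        unfolding G_def using dvd_trans by blast+
      then show "real (card (B (m, c))) \<le> real G / real m"
        unfolding B_def using card_residue_class_le by simp
    qed
    also have "\<dots> = real G * (\<Sum>(m, c)\<in>R. 1 / real m)"
      by (simp add: sum_distrib_left split_beta)
    also have "\<dots> < real G * e" using R(3) G by simp
    finally have "real (card ({0..<int G} - A)) < real G * e" .
    moreover have "card ({0..<int G} - A) = G - card A"
      using card_Diff_subset[OF finA sub] by simp
    moreover have "card A \<le> G" using card_mono[OF _ sub] by simp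
    ultimately have "real G - real (card A) < real G * e" "real (card A) \<le> real G"
      by (simp_all add: of_nat_diff)
    then have "norm (real (card A) / real G - 1) < e"
      using G \<open>e > 0\<close> by (simp add: field_simps abs_if)
    then show ?thesis by (simp add: count_first_def A_def G_def)
  qed
  then show "\<exists>no. \<forall>l\<ge>no. norm (real (count_first n a l) / real (lcm_first n l) - 1) < e"
    by blast
qed

section \<open>Splitting a residue class along powers of two\<close>

lemma three_times_plus_one_cong_iff:
  fixes t :: int
  shows "\<exists>u :: int. \<forall>y. [3 * y + 1 = t] (mod 2 ^ k) \<longleftrightarrow> [y = u] (mod 2 ^ k)"
proof -
  have cop: "coprime (3 :: int) (2 ^ k)" by simp
  then obtain s :: int where s: "[3 * s = 1] (mod 2 ^ k)" using cong_solve_coprime_int by metis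
  have "[3 * y + 1 = t] (mod 2 ^ k) \<longleftrightarrow> [y = s * (t - 1)] (mod 2 ^ k)" for y
  proof -
    have r: "[3 * (s * (t - 1)) = t - 1] (mod 2 ^ k)"
      using cong_scalar_right[OF s, of "t - 1"] by (simp add: mult.assoc)
    have "[3 * y + 1 = t] (mod 2 ^ k) \<longleftrightarrow> [3 * y = t - 1] (mod 2 ^ k)"
      by (simp add: cong_iff_dvd_diff algebra_simps)
    also have "\<dots> \<longleftrightarrow> [3 * y = 3 * (s * (t - 1))] (mod 2 ^ k)"
      using r cong_sym cong_trans by blast
    also have "\<dots> \<longleftrightarrow> [y = s * (t - 1)] (mod 2 ^ k)"
      using cop by (rule cong_mult_lcancel)
    finally show ?thesis .
  qed
  then show ?thesis by blast
qed

text \<open>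
  The \<open>j\<close>-th class consists of those \<open>y\<close> for which \<open>2 ^ j\<close> is
  the exact power of two dividing \<open>3 * y + 1\<close>, and the class left over after
  \<open>K\<close> steps of those for which \<open>2 ^ K\<close> divides it. No integer is left over
  for ever, because \<open>3 * y + 1\<close> is never \<open>0\<close>. By contrast
  \<open>y\<close> itself in place of \<open>3 * y + 1\<close> would leave the integer
  \<open>0\<close> uncovered.
\<close>

lemma dyadic_splitting:
  "\<exists>(u :: nat \<Rightarrow> int) v. (\<forall>y. \<exists>j. [y = u j] (mod 2 ^ Suc j)) \<and>
     (\<forall>K y. (\<exists>j<K. [y = u j] (mod 2 ^ Suc j)) \<or> [y = v K] (mod 2 ^ K))"
proof -
  have "\<forall>j. \<exists>u :: int. \<forall>y. [3 * y + 1 = 2 ^ j] (mod 2 ^ Suc j) \<longleftrightarrow> [y = u] (mod 2 ^ Suc j)"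
    by (intro allI three_times_plus_one_cong_iff)
  from choice[OF this] obtain u :: "nat \<Rightarrow> int"
    where u: "\<forall>j y. [3 * y + 1 = 2 ^ j] (mod 2 ^ Suc j) \<longleftrightarrow> [y = u j] (mod 2 ^ Suc j)" ..
  have "\<forall>K. \<exists>v :: int. \<forall>y. [3 * y + 1 = 0] (mod 2 ^ K) \<longleftrightarrow> [y = v] (mod 2 ^ K)"
    by (intro allI three_times_plus_one_cong_iff)
  from choice[OF this] obtain v :: "nat \<Rightarrow> int"
    where v: "\<forall>K y. [3 * y + 1 = 0] (mod 2 ^ K) \<longleftrightarrow> [y = v K] (mod 2 ^ K)" ..
  have part: "(\<exists>j<K. [y = u j] (mod 2 ^ Suc j)) \<or> 2 ^ K dvd 3 * y + 1" for K y
  proof (induction K)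
    case (Suc K)
    show ?case
    proof (cases "\<exists>j<K. [y = u j] (mod 2 ^ Suc j)")
      case True
      then show ?thesis by (meson less_SucI)
    next
      case False
      with Suc.IH obtain q where q: "3 * y + 1 = 2 ^ K * q" by blast
      show ?thesis
      proof (cases "even q")
        case True
        then show ?thesis by (auto simp: q elim!: evenE)
      next
        case False
        then obtain p where "q = 2 * p + 1" by (rule oddE)
        then have "3 * y + 1 - 2 ^ K = 2 ^ Suc K * p" unfolding q by (simp add: algebra_simps)
        then have "[3 * y + 1 = 2 ^ K] (mod 2 ^ Suc K)"
          by (simp add: cong_iff_dvd_diff)
        then show ?thesis using u by blast
      qed
    qed
  qed simp
  have "\<exists>j. [y = u j] (mod 2 ^ Suc j)" for y
  proof (rule ccontr)
    assume "\<not> ?thesis"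
    with part have dvd: "2 ^ K dvd 3 * y + 1" for K by blast
    have "3 * y + 1 \<noteq> 0" by presburger
    moreover have "\<bar>3 * y + 1\<bar> < 2 ^ nat \<bar>3 * y + 1\<bar>"
      using of_nat_less_two_power[of "nat \<bar>3 * y + 1\<bar>", where 'a = int] by simp
    ultimately show False using dvd[of "nat \<bar>3 * y + 1\<bar>"] zdvd_imp_le[of _ "\<bar>3 * y + 1\<bar>"]
      by force
  qed
  with part v show ?thesis
    unfolding cong_0_iff by blast
qed

lemma dyadic_splitting_of_class:
  fixes M :: nat and r :: int
  shows "\<exists>(u :: nat \<Rightarrow> int) v. \<forall>x. [x = r] (mod int M) \<longrightarrow>
     (\<exists>j. [x = u j] (mod int (M * 2 ^ Suc j))) \<and>
     (\<forall>K. (\<exists>j<K. [x = u j] (mod int (M * 2 ^ Suc j))) \<or> [x = v K] (mod int (M * 2 ^ K)))"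
proof -
  obtain u v :: "nat \<Rightarrow> int" where uv: "\<And>y. \<exists>j. [y = u j] (mod 2 ^ Suc j)"
    "\<And>y K. (\<exists>j<K. [y = u j] (mod 2 ^ Suc j)) \<or> [y = v K] (mod 2 ^ K)"
    using dyadic_splitting by blast
  have scale: "[r + int M * y = r + int M * w] (mod int (M * 2 ^ i))"
    if "[y = w] (mod 2 ^ i)" for y w :: int and i
    using that by (auto simp: cong_iff_dvd_diff algebra_simps simp flip: right_diff_distrib)
  show ?thesis
  proof (rule exI[of _ "\<lambda>j. r + int M * u j"], rule exI[of _ "\<lambda>K. r + int M * v K"],
      intro allI impI)
    fix x assume "[x = r] (mod int M)"
    then obtain y where "x = r + int M * y"
      by (metis cong_iff_lin cong_sym)
    then show "(\<exists>j. [x = r + int M * u j] (mod int (M * 2 ^ Suc j))) \<and>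
      (\<forall>K. (\<exists>j<K. [x = r + int M * u j] (mod int (M * 2 ^ Suc j))) \<or>
           [x = r + int M * v K] (mod int (M * 2 ^ K)))"
      using uv(1)[of y] uv(2)[where y = y] scale[where y = y] by blast
  qed
qed

section \<open>From a finite cover to a strong infinite one\<close>

text \<open>
  The moduli in \<open>F\<close> are used as they are, those in \<open>T\<close> are replaced by their
  chains of proper dyadic multiples. Two chains meet exactly when one of their starting points is a
  power of two times the other, so the condition \<open>T_indep\<close> makes the chains disjoint.
  A modulus may belong to both \<open>F\<close> and \<open>T\<close>, with different residues.
\<close>

lemma strong_covering_from_finite_cover:
  fixes F T :: "nat set" and b c :: "nat \<Rightarrow> int"
  assumes fin: "finite F" "finite T" and "T \<noteq> {}"
    and F1: "\<And>m. m \<in> F \<Longrightarrow> m > 1" and T0: "\<And>M. M \<in> T \<Longrightarrow> M > 0"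
    and T_indep: "\<And>M M' d. M \<in> T \<Longrightarrow> M' \<in> T \<Longrightarrow> M = M' * 2 ^ d \<Longrightarrow> M = M'"
    and disj: "\<And>M j. M \<in> T \<Longrightarrow> M * 2 ^ Suc j \<notin> F"
    and cover: "\<And>x. (\<exists>m\<in>F. [x = b m] (mod int m)) \<or> (\<exists>M\<in>T. [x = c M] (mod int M))"
  shows "\<exists>n a. strong_distinct_infinite_covering_system n a \<and>
    range n = F \<union> {M * 2 ^ Suc j |M j. M \<in> T}"
proof -
  have choice2: "\<exists>u v. \<forall>M. P M (u M) (v M)" if "\<forall>M. \<exists>u v. P M u v"
    for P :: "nat \<Rightarrow> (nat \<Rightarrow> int) \<Rightarrow> (nat \<Rightarrow> int) \<Rightarrow> bool"
    using that by metis
  define S where "S = F \<union> {M * 2 ^ Suc j |M j. M \<in> T}"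
  define dy where "dy = (\<lambda>(M :: nat, j). M * 2 ^ Suc j)"
  have dy_inj: "M = M' \<and> j = j'"
    if "M * 2 ^ Suc j = M' * 2 ^ Suc j'" "M \<in> T" "M' \<in> T" for M M' j j'
  proof -
    have "M = M'"
    proof (cases "j \<le> j'")
      case True
      then have "M' * 2 ^ Suc j' = M' * 2 ^ (j' - j) * 2 ^ Suc j"
        by (simp flip: power_add)
      with that(1) have "M * 2 ^ Suc j = M' * 2 ^ (j' - j) * 2 ^ Suc j" by (simp only:)
      then have "M = M' * 2 ^ (j' - j)" by (simp only: mult_cancel2) simp
      with that(2,3) show ?thesis using T_indep by metis
    next
      case False
      then have "M * 2 ^ Suc j = M * 2 ^ (j - j') * 2 ^ Suc j'"
        by (simp flip: power_add)
      with that(1) have "M' * 2 ^ Suc j' = M * 2 ^ (j - j') * 2 ^ Suc j'" by (simp only:)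
      then have "M' = M * 2 ^ (j - j')" by (simp only: mult_cancel2) simp
      with that(2,3) show ?thesis using T_indep by metis
    qed
    with that T0 show ?thesis by auto
  qed
  have inj: "inj_on dy (T \<times> UNIV)"
  proof (rule inj_onI)
    fix p q assume "p \<in> T \<times> UNIV" "q \<in> T \<times> UNIV" "dy p = dy q"
    with dy_inj[of "fst p" "snd p" "fst q" "snd q"] show "p = q"
      by (auto simp: dy_def split_beta prod_eq_iff)
  qed
  have "infinite (dy ` (T \<times> UNIV))"
    using inj \<open>T \<noteq> {}\<close> by (simp add: finite_image_iff finite_cartesian_product_iff)
  moreover have "dy ` (T \<times> UNIV) \<subseteq> S" by (auto simp: S_def dy_def)
  ultimately have infS: "infinite S" using finite_subset by blast
  have "\<exists>u v. \<forall>M x. [x = c M] (mod int M) \<longrightarrow>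
     (\<exists>j. [x = u M j] (mod int (M * 2 ^ Suc j))) \<and>
     (\<forall>K. (\<exists>j<K. [x = u M j] (mod int (M * 2 ^ Suc j))) \<or> [x = v M K] (mod int (M * 2 ^ K)))"
    by (intro choice2 allI dyadic_splitting_of_class)
  then obtain u v :: "nat \<Rightarrow> nat \<Rightarrow> int" where
    u: "\<And>M x. [x = c M] (mod int M) \<Longrightarrow> \<exists>j. [x = u M j] (mod int (M * 2 ^ Suc j))" and
    v: "\<And>M x K. [x = c M] (mod int M) \<Longrightarrow>
      (\<exists>j<K. [x = u M j] (mod int (M * 2 ^ Suc j))) \<or> [x = v M K] (mod int (M * 2 ^ K))"
    by blast
  define res where "res m = (if m \<in> F then b m
    else case inv_into (T \<times> UNIV) dy m of (M, j) \<Rightarrow> u M j)" for m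
  have res_F: "res m = b m" if "m \<in> F" for m using that by (simp add: res_def)
  have res_T: "res (M * 2 ^ Suc j) = u M j" if "M \<in> T" for M j
    using inv_into_f_f[OF inj, of "(M, j)"] that disj[OF that, of j]
    by (simp add: res_def dy_def)
  define n where "n = enumerate S"
  define a where "a k = res (n k)" for k
  have range_n: "range n = S" unfolding n_def using infS by (rule range_enumerate)
  have inj_n: "inj n"
    unfolding n_def using infS by (simp add: strict_mono_enumerate strict_mono_imp_inj_on)
  have S1: "m > 1" if "m \<in> S" for m
  proof -
    have "M * 2 ^ Suc j > 1" if "M \<in> T" for M j
      using T0[OF that] one_less_power[of "2 :: nat" "Suc j"]
      by (intro less_le_trans[of 1 "2 ^ Suc j" "M * 2 ^ Suc j"]) simp_all
    with that F1 show ?thesis by (auto simp: S_def)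
  qed
  have n1: "n k > 1" for k using S1 range_n by blast
  have member: "\<exists>k. [x = a k] (mod int (n k))" if "m \<in> S" "[x = res m] (mod int m)" for m x
    using that range_n by (metis a_def imageE)
  have covers: "\<exists>k. [x = a k] (mod int (n k))" for x
    using cover[of x]
  proof (elim disjE bexE)
    fix m assume "m \<in> F" "[x = b m] (mod int m)"
    then show ?thesis using member[of m x] res_F by (simp add: S_def)
  next
    fix M assume M: "M \<in> T" "[x = c M] (mod int M)"
    then obtain j where "[x = u M j] (mod int (M * 2 ^ Suc j))" using u by blast
    then show ?thesis
      using member[of "M * 2 ^ Suc j" x] res_T M(1) unfolding S_def by auto
  qed
  have "(\<lambda>k. real (count_first n a k) / real (lcm_first n k)) \<longlonglongrightarrow> 1"
  proof (rule covered_density_tendsto_1)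
    show "n i > 0" for i using n1[of i] by simp
  next
    fix e :: real assume "e > 0"
    have "(\<lambda>K. real (card T) * (1 / 2) ^ K) \<longlonglongrightarrow> real (card T) * 0"
      by (intro tendsto_mult tendsto_const LIMSEQ_power_zero) simp
    then have "(\<lambda>K. real (card T) * (1 / 2) ^ Suc K) \<longlonglongrightarrow> 0"
      by (simp add: LIMSEQ_Suc)
    then have "\<forall>\<^sub>F K in sequentially. real (card T) * (1 / 2) ^ Suc K < e"
      using \<open>e > 0\<close> by (rule order_tendstoD)
    then obtain K' where K': "real (card T) * (1 / 2) ^ Suc K' < e"
      using eventually_happens'[OF sequentially_bot] by blast
    \<comment> \<open>A positive \<open>K\<close> makes \<open>M * 2 ^ K\<close> itself a modulus of the chain,
      so that it divides the least common multiple.\<close>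
    define K where "K = Suc K'"
    define S' where "S' = F \<union> dy ` (T \<times> {..<K})"
    have "finite S'" using fin by (simp add: S'_def)
    moreover have "S' \<subseteq> range n" unfolding range_n by (auto simp: S'_def S_def dy_def)
    ultimately obtain I where I: "finite I" "S' = n ` I"
      using finite_subset_image by metis
    then obtain k where k: "I \<subseteq> {..<k}" using finite_nat_iff_bounded by blast
    have early: "\<exists>i<k. [x = a i] (mod int (n i))"
      if m: "m \<in> S'" "[x = res m] (mod int m)" for m x
    proof -
      obtain i where "i < k" "m = n i" using m(1) I(2) k by blast
      with m(2) show ?thesis by (auto simp: a_def)
    qed
    define R where "R = (\<lambda>M. (M * 2 ^ K, v M K)) ` T"
    have "finite R" using fin by (simp add: R_def)
    moreover have "m > 0 \<and> m dvd lcm_first n k" if "(m, r) \<in> R" for m r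
    proof -
      obtain M where M: "M \<in> T" "m = M * 2 ^ K" using \<open>(m, r) \<in> R\<close> by (auto simp: R_def)
      then have "m \<in> S'" by (force simp: S'_def dy_def K_def)
      then have "m \<in> n ` {..<k}" using I k by blast
      with M T0 show ?thesis by (simp add: lcm_first_def)
    qed
    moreover have "(\<Sum>(m, r)\<in>R. 1 / real m) < e"
    proof -
      have "(\<Sum>(m, r)\<in>R. 1 / real m) \<le> (\<Sum>M\<in>T. 1 / real (M * 2 ^ K))"
        unfolding R_def using sum_image_le[OF fin(2), where f = "\<lambda>M. (M * 2 ^ K, v M K)"
          and g = "\<lambda>(m, r). 1 / real m"] by (simp add: o_def)
      also have "\<dots> \<le> (\<Sum>M\<in>T. (1 / 2) ^ K)"
      proof (intro sum_mono)
        fix M assume "M \<in> T"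
        then have "real M \<ge> 1" using T0 by (simp add: Suc_leI)
        then show "1 / real (M * 2 ^ K) \<le> (1 / 2) ^ K"
          by (simp add: power_one_over field_simps)
      qed
      also have "\<dots> < e" using K' by (simp add: K_def)
      finally show ?thesis .
    qed
    moreover have "(\<exists>i<k. [x = a i] (mod int (n i))) \<or> (\<exists>(m, r)\<in>R. [x = r] (mod int m))" for x
      using cover[of x]
    proof (elim disjE bexE)
      fix m assume "m \<in> F" "[x = b m] (mod int m)"
      then show ?thesis using early[of m x] res_F by (simp add: S'_def)
    next
      fix M assume M: "M \<in> T" "[x = c M] (mod int M)"
      show ?thesis
      proof (cases "\<exists>j<K. [x = u M j] (mod int (M * 2 ^ Suc j))")
        case True
        then obtain j where j: "j < K" "[x = u M j] (mod int (M * 2 ^ Suc j))" by blast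
        then have "M * 2 ^ Suc j \<in> S'" using M(1) by (force simp: S'_def dy_def)
        then show ?thesis using early j(2) res_T[OF M(1)] by metis
      next
        case False
        with v[OF M(2), of K] have "[x = v M K] (mod int (M * 2 ^ K))" by blast
        then show ?thesis using M(1) by (auto simp: R_def)
      qed
    qed
    ultimately show "\<exists>(R :: (nat \<times> int) set) k. finite R \<and>
      (\<forall>(m, c)\<in>R. m > 0 \<and> m dvd lcm_first n k) \<and> (\<Sum>(m, c)\<in>R. 1 / real m) < e \<and>
      (\<forall>x. (\<exists>i<k. [x = a i] (mod int (n i))) \<or> (\<exists>(m, c)\<in>R. [x = c] (mod int m)))"
      by (intro exI[of _ R] exI[of _ k]) blast
  qed
  with inj_n n1 covers have "strong_distinct_infinite_covering_system n a"
    by (simp add: strong_distinct_infinite_covering_system_def distinct_infinite_system_def)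
  with range_n show ?thesis unfolding S_def by blast
qed

section \<open>A cover of the integers modulo 180\<close>

text \<open>
  Pairs are a modulus and a residue. The classes in \<open>heads\<close> are part of the final system;
  those in \<open>tails\<close> are the ones to be split along powers of two. For each divisor
  \<open>d\<close> of \<open>45\<close> there is one tail, whose modulus is a power of two times
  \<open>d\<close>, so that the chains are disjoint; for \<open>d > 1\<close> that modulus is
  also the largest head with odd part \<open>d\<close>.
\<close>

definition heads :: "(nat \<times> int) list" where
  "heads = [(6, 2), (12, 3), (10, 4), (20, 16), (9, 4), (18, 16), (36, 19),
            (15, 12), (30, 18), (45, 28), (90, 10)]"

definition tails :: "(nat \<times> int) list" where
  "tails = [(4, 1), (12, 11), (20, 6), (36, 7), (30, 0), (90, 82)]"

text \<open>
  The check over one period is mechanical, but it can be followed by hand.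
  \<^item> \<open>1\<close> mod \<open>4\<close>, \<open>2\<close> mod \<open>6\<close>, \<open>3\<close>
    mod \<open>12\<close> and \<open>11\<close> mod \<open>12\<close> leave
    \<open>7\<close> mod \<open>12\<close> and the even numbers that are \<open>0\<close> or
    \<open>1\<close> mod \<open>3\<close>.
  \<^item> \<open>4\<close> mod \<open>10\<close> and the two classes mod \<open>20\<close> cover the
    even numbers that are \<open>4\<close> or \<open>1\<close> mod \<open>5\<close>.
  \<^item> \<open>4\<close> mod \<open>9\<close> and the two classes mod \<open>36\<close> cover
    \<open>7\<close> mod \<open>12\<close>; with \<open>16\<close> mod \<open>18\<close>, only
    \<open>1\<close> mod \<open>9\<close> is left of the even numbers that are \<open>1\<close>
    mod \<open>3\<close>.
  \<^item> What is left is even, \<open>0\<close> mod \<open>3\<close> or \<open>1\<close> mod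
    \<open>9\<close>, and \<open>0\<close>, \<open>2\<close> or \<open>3\<close> mod
    \<open>5\<close>. The classes \<open>0\<close> mod \<open>30\<close>, \<open>12\<close> mod
    \<open>15\<close>, \<open>18\<close> mod \<open>30\<close> settle the multiples of
    \<open>3\<close>, and \<open>10\<close> mod \<open>90\<close>, \<open>82\<close> mod
    \<open>90\<close>, \<open>28\<close> mod \<open>45\<close> settle the others.
\<close>

lemma heads_tails_cover: "\<exists>(m, r)\<in>set (heads @ tails). [x = r] (mod int m)"
proof -
  have "list_all (\<lambda>y. list_ex (\<lambda>(m, r). y mod int m = r mod int m) (heads @ tails)) [0..179]"
    by code_simp
  moreover have "x mod 180 \<in> set [0..179]" by simp
  ultimately have "list_ex (\<lambda>(m, r). (x mod 180) mod int m = r mod int m) (heads @ tails)"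
    unfolding list_all_iff by blast
  then obtain m r where mr: "(m, r) \<in> set (heads @ tails)" "(x mod 180) mod int m = r mod int m"
    by (auto simp: list_ex_iff)
  moreover from mr(1) have "int m dvd 180" by (auto simp: heads_def tails_def)
  ultimately have "[x = r] (mod int m)" by (simp add: cong_def mod_mod_cancel)
  with mr(1) show ?thesis by blast
qed

theorem theorem1p10:
  shows "\<exists>(n :: nat \<Rightarrow> nat) (a :: nat \<Rightarrow> int).
    strong_distinct_infinite_covering_system n a \<and>
    least_modulus n = 6 \<and>
    (\<forall>k. \<exists>\<alpha> \<beta> \<gamma> :: nat. \<beta> \<le> 2 \<and> \<gamma> \<le> 1 \<and> n k = 2 ^ \<alpha> * 3 ^ \<beta> * 5 ^ \<gamma>)"
proof -
  define F where "F = fst ` set heads"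
  define T where "T = fst ` set tails"
  have F: "F = {6, 12, 10, 20, 9, 18, 36, 15, 30, 45, 90}" by (simp add: F_def heads_def)
  have T: "T = {4, 12, 20, 36, 30, 90}" by (simp add: T_def tails_def)
  \<comment> \<open>All elements of \<open>F\<close> and \<open>T\<close> are at most \<open>90\<close>, so only finitely many exponents
    can produce a coincidence between moduli, and these are checked one by one.\<close>
  have small: "d < 7" if "M * 2 ^ d \<le> 90" "M > 0" for M d :: nat
  proof (rule ccontr)
    assume "\<not> d < 7"
    then have "(2 :: nat) ^ 7 \<le> 2 ^ d" by (intro power_increasing) auto
    also have "\<dots> \<le> M * 2 ^ d" using that(2) by simp
    finally show False using that(1) by simp
  qed
  have "\<exists>n a. strong_distinct_infinite_covering_system n a \<and>
    range n = F \<union> {M * 2 ^ Suc j |M j. M \<in> T}"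
  proof (rule strong_covering_from_finite_cover)
    show "M = M'" if "M \<in> T" "M' \<in> T" "M = M' * 2 ^ d" for M M' d
    proof -
      have "M \<le> 90" "M' > 0" using that(1,2) by (auto simp: T)
      then have "d \<in> set [0..<7]" using small[of M' d] that(3) by simp
      moreover have "\<forall>M\<in>T. \<forall>M'\<in>T. \<forall>d\<in>set [0..<7]. M = M' * 2 ^ d \<longrightarrow> M = M'"
        unfolding T by code_simp
      ultimately show ?thesis using that by blast
    qed
    show "M * 2 ^ Suc j \<notin> F" if "M \<in> T" for M j
    proof
      assume mem: "M * 2 ^ Suc j \<in> F"
      then have "M * 2 ^ Suc j \<le> 90" unfolding F by auto
      moreover have "M > 0" using that by (auto simp: T)
      ultimately have "j \<in> set [0..<6]" using small[of M "Suc j"] by simp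
      moreover have "\<forall>M\<in>T. \<forall>j\<in>set [0..<6]. M * 2 ^ Suc j \<notin> F"
        unfolding F T by code_simp
      ultimately show False using mem that by blast
    qed
    show "(\<exists>m\<in>F. [x = the (map_of heads m)] (mod int m)) \<or>
      (\<exists>M\<in>T. [x = the (map_of tails M)] (mod int M))" for x
    proof -
      have dist: "distinct (map fst heads)" "distinct (map fst tails)"
        by (simp_all add: heads_def tails_def)
      obtain m r where mr: "(m, r) \<in> set heads \<or> (m, r) \<in> set tails" "[x = r] (mod int m)"
        using heads_tails_cover[of x] by auto
      from mr(1) show ?thesis
      proof
        assume "(m, r) \<in> set heads"
        with dist(1) have "m \<in> F" "the (map_of heads m) = r" by (force simp: F_def)+
        with mr(2) show ?thesis by blast
      next
        assume "(m, r) \<in> set tails"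
        with dist(2) have "m \<in> T" "the (map_of tails m) = r" by (force simp: T_def)+
        with mr(2) show ?thesis by blast
      qed
    qed
  qed (auto simp: F T)
  then obtain n a where n: "strong_distinct_infinite_covering_system n a"
    and range: "range n = F \<union> {M * 2 ^ Suc j |M j. M \<in> T}" by blast
  have least: "least_modulus n = 6"
    unfolding least_modulus_def range
  proof (rule Least_equality)
    fix m assume "m \<in> F \<union> {M * 2 ^ Suc j |M j. M \<in> T}"
    then show "6 \<le> m"
    proof
      assume "m \<in> {M * 2 ^ Suc j |M j. M \<in> T}"
      then obtain M j where "M \<in> T" "m = M * 2 * 2 ^ j" by (force simp: mult.assoc)
      moreover from this have "4 * 2 * 1 \<le> M * 2 * 2 ^ j"
        by (intro mult_le_mono) (auto simp: T)
      ultimately show ?thesis by simp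
    qed (auto simp: F)
  qed (simp add: F)
  have smooth_F: "\<exists>\<alpha> \<beta> \<gamma>. \<beta> \<le> 2 \<and> \<gamma> \<le> 1 \<and> m = 2 ^ \<alpha> * 3 ^ \<beta> * 5 ^ \<gamma>" if "m \<in> F \<union> T" for m :: nat
  proof -
    have "list_all (\<lambda>m :: nat. list_ex (\<lambda>\<alpha>. list_ex (\<lambda>\<beta>. list_ex (\<lambda>\<gamma>.
      m = 2 ^ \<alpha> * 3 ^ \<beta> * 5 ^ \<gamma>) [0, 1]) [0, 1, 2]) [0, 1, 2])
      [6, 10, 9, 18, 15, 45, 4, 12, 20, 36, 30, 90]"
      by code_simp
    moreover have "m \<in> set [6, 10, 9, 18, 15, 45, 4, 12, 20, 36, 30, 90]"
      using that by (auto simp: F T)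
    ultimately obtain \<alpha> \<beta> \<gamma> where "m = 2 ^ \<alpha> * 3 ^ \<beta> * 5 ^ \<gamma>"
      "\<beta> \<in> set [0, 1, 2]" "\<gamma> \<in> set [0, 1]"
      unfolding list_all_iff list_ex_iff by blast
    then show ?thesis by (intro exI[of _ \<alpha>] exI[of _ \<beta>] exI[of _ \<gamma>]) auto
  qed
  have "\<exists>\<alpha> \<beta> \<gamma>. \<beta> \<le> 2 \<and> \<gamma> \<le> 1 \<and> n k = 2 ^ \<alpha> * 3 ^ \<beta> * 5 ^ \<gamma>" for k
  proof -
    have "n k \<in> F \<union> {M * 2 ^ Suc j |M j. M \<in> T}" using range by blast
    then show ?thesis
    proof
      assume "n k \<in> {M * 2 ^ Suc j |M j. M \<in> T}"
      then obtain M j where M: "M \<in> T" "n k = M * 2 ^ Suc j" by auto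
      then obtain \<alpha> \<beta> \<gamma> where *: "\<beta> \<le> 2" "\<gamma> \<le> 1" "M = 2 ^ \<alpha> * 3 ^ \<beta> * 5 ^ \<gamma>"
        using smooth_F[of M] by blast
      then have "n k = 2 ^ (\<alpha> + Suc j) * 3 ^ \<beta> * 5 ^ \<gamma>" using M by (simp add: power_add)
      with * show ?thesis by blast
    qed (use smooth_F in blast)
  qed
  with n least show ?thesis by blast
qed

end
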